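(* Let $n$ be a non-negative integer and let $$S_n=\sum_{k=1}^\infty \frac{\frac18\psi\left(\frac{2k+2n+5}{4}\right)-\psi\left(\frac{k+2n+5}{4}\right)+\psi\left(\frac{k+2n+3}{4}\right)-\frac18\psi\left(\frac{2k+2n+3}{4}\right)}{k^2}.$$ Then: (i) if $n=0$: $S_0=2(1+\ln 2)-\frac{7\pi^2}{12}+\frac{5\pi^3}{96}$; (ii) if $n=1$: $S_1=-\frac89\left(\frac53+2\ln 2\right)+\frac{7\pi^2}{18}-\frac{5\pi^3}{96}$; (iii) if $n$ is odd and $n\neq1$: $$\begin{aligned}S_n={}&-\frac{40}{27}-8\sum_{j=1}^{\frac{n-1}{2}}\frac{(2j+1)(2H_{4j+1}+H_{2j})}{(4j+3)^2(4j+1)^2}+4\sum_{j=1}^{\frac{n-1}{2}}\frac{3j+2}{(2j+1)(4j+3)^3}+\frac{7\pi^2}{2}\left(\frac19+\frac13\sum_{j=1}^{\frac{n-1}{2}}\frac{1}{(4j+3)(4j+1)}\right)\\&-16\ln 2\left(\frac19+\sum_{j=1}^{\frac{n-1}{2}}\frac{2j+1}{(4j+3)^2(4j+1)^2}\right)-\frac{5\pi^3}{96};\end{aligned}$$ (iv) if $n$ is even: $$\begin{aligned}S_n={}&2-16\sum_{j=0}^{\frac{n-2}{2}}\frac{(j+1)(2H_{4j+3}+H_{2j+1})}{(4j+5)^2(4j+3)^2}+\sum_{j=0}^{\frac{n-2}{2}}\frac{6j+7}{(j+1)(4j+5)^3}-\frac{7\pi^2}{2}\left(\frac16-\frac13\sum_{j=0}^{\frac{n-2}{2}}\frac{1}{(4j+5)(4j+3)}\right)\\&+2\ln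 2\left(1-16\sum_{j=0}^{\frac{n-2}{2}}\frac{j+1}{(4j+5)^2(4j+3)^2}\right)+\frac{5\pi^3}{96}.\end{aligned}$$
   Context: $\psi=\Gamma'/\Gamma$ is the digamma function and $H_n=\sum_{k=1}^n\frac1k$ is the $n$-th harmonic number. Empty sums (such as $\sum_{j=0}^{-1}$) are $0$. *)

theory Defs
  imports "HOL-Analysis.Analysis"
begin

definition psi_summand :: "nat \<Rightarrow> nat \<Rightarrow> real" where
  "psi_summand n k =
     (1/8 * Digamma ((2 * real k + 2 * real n + 5) / 4)
      - Digamma ((real k + 2 * real n + 5) / 4)
      + Digamma ((real k + 2 * real n + 3) / 4)
      - 1/8 * Digamma ((2 * real k + 2 * real n + 3) / 4)) / (real k)\<^sup>2"

end

theory Submission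
  imports Defs
begin

text \<open>
  By the recurrence of the digamma function the sum $S_n + S_{n+1}$ is elementary, namely
  $-\frac{7\pi^2}{12 N} + (2 H_N + H_{n+1} + 2 \ln 2)/N^2$ with $N = 2n+3$. As $S_n \to 0$, everything
  reduces to $S_0$, hence to the Euler sum
  $\sum_i (-1)^i (2 H_{2i+1} + H_i + 2 \ln 2)/(2i+1)^2 = 3\pi^3/32$. Expanding the harmonic numbers turns
  its left-hand side into $4A + 2B$, where $N$, $K$ run over the odd and $k$ over the even positive
  integers, $\chi$ is the nontrivial character modulo 4, and
  $A = \sum \chi(N)/(N K (N+K))$, $B = \sum \chi(N)/(N k (N+k))$.

  With $E(k) = \sum_{N<k} \chi(N)/N$ and $D = \sum_k E(k)/k^2$, summing $A$ along the antidiagonals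
  and $B$ over $N$ first expresses both, up to a multiple of $\pi^3$, by sums $\sum_k \pm E(k)/k^2$, and gives $B + A - D = \pi^3/64$.
  Double sum manipulations yield no second relation; it comes from the form
  $\omega = (\mathrm{artanh}\,t/t - \ln t/(1-t^2))\,dt$, which is invariant under
  $t \mapsto (1-t)/(1+t)$ and has $\int_0^1 \omega = \pi^2/4$. The substitution maps $\arctan t$ to
  $\pi/4 - \arctan t$, so $A + D = \int_0^1 \arctan t\,\omega = \pi^3/32$.
\<close>

section \<open>A self-dual density on the unit interval\<close>

text \<open>Splitting off the first term leaves \<open>a 0\<close> minus a partial sum of the
  shifted sequence, which by induction lies between 0 and \<open>a 1\<close>. The bound later
  dominates the partial sums of the arctangent series.\<close>

lemma alternating_partial_sum_bounds:
  fixes a :: "nat \<Rightarrow> real"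
  assumes "\<And>i. 0 \<le> a i" "\<And>i. a (Suc i) \<le> a i"
  shows "0 \<le> (\<Sum>i<n. (-1)^i * a i) \<and> (\<Sum>i<n. (-1)^i * a i) \<le> a 0"
  using assms
proof (induction n arbitrary: a)
  case 0
  then show ?case by simp
next
  case (Suc n)
  have "(\<Sum>i<Suc n. (-1)^i * a i) = a 0 - (\<Sum>i<n. (-1)^i * a (Suc i))"
    by (subst sum.lessThan_Suc_shift) (simp add: sum_negf)
  moreover have "0 \<le> (\<Sum>i<n. (-1)^i * a (Suc i)) \<and> (\<Sum>i<n. (-1)^i * a (Suc i)) \<le> a 1"
    using Suc.IH[of "\<lambda>i. a (Suc i)"] Suc.prems by simp
  moreover have "a 1 \<le> a 0" using Suc.prems(2)[of 0] by simp
  ultimately show ?case using Suc.prems(1)[of 1] by linarith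
qed

lemma power_has_integral_01:
  "((\<lambda>t::real. t ^ n) has_integral 1 / (real n + 1)) {0<..<1}"
proof -
  have "((\<lambda>t::real. t ^ n) has_integral (1 ^ Suc n / Suc n - 0 ^ Suc n / Suc n)) {0..1}"
  proof (rule fundamental_theorem_of_calculus)
    fix x :: real
    have "((\<lambda>t::real. t ^ Suc n / Suc n) has_real_derivative x ^ n) (at x within {0..1})"
      by (rule derivative_eq_intros refl | simp)+
    then show "((\<lambda>t::real. t ^ Suc n / Suc n) has_vector_derivative x ^ n) (at x within {0..1})"
      by (simp add: has_real_derivative_iff_has_vector_derivative)
  qed simp
  then have "((\<lambda>t::real. t ^ n) has_integral 1 / (real n + 1)) (cbox 0 1)"
    by (simp add: add_ac)
  then have "((\<lambda>t::real. t ^ n) has_integral 1 / (real n + 1)) (box 0 1)"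
    by (simp only: has_integral_open_interval)
  then show ?thesis by simp
qed

text \<open>Integration by parts provides the primitive \<open>F\<close>. It is differentiable only
  in the interior, so the fundamental theorem is applied in the version that asks for mere
  continuity at the endpoints.\<close>

lemma power_ln_has_integral_01:
  "((\<lambda>t::real. t ^ n * - ln t) has_integral 1 / (real n + 1)^2) {0<..<1}"
proof -
  define F where "F = (\<lambda>t::real. t ^ Suc n / (real n + 1)^2 - t ^ Suc n * ln t / (real n + 1))"
  have "((\<lambda>t::real. t ^ n * - ln t) has_integral (F 1 - F 0)) {0..1}"
  proof (rule fundamental_theorem_of_calculus_interior)
    have tl: "((\<lambda>t::real. t ^ Suc n * ln t) \<longlongrightarrow> 0) (at 0 within {0..1})"
    proof -
      have "((\<lambda>t::real. t * ln t) \<longlongrightarrow> 0) (at_right 0)"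
      proof -
        \<comment> \<open>With u = 1/t the product t ln t becomes -(ln u)/u, where u tends to
          infinity.\<close>
        have "((\<lambda>t::real. - (ln (inverse t) / inverse t)) \<longlongrightarrow> - 0) (at_right 0)"
          by (intro tendsto_minus filterlim_compose[OF ln_x_over_x_tendsto_0 filterlim_inverse_at_top_right])
        moreover have "\<forall>\<^sub>F t::real in at_right 0. - (ln (inverse t) / inverse t) = t * ln t"
          using eventually_at_right_less[of 0] by eventually_elim (simp add: ln_inverse divide_inverse mult.commute)
        ultimately show ?thesis by (simp add: tendsto_cong)
      qed
      moreover have "((\<lambda>t::real. t ^ n) \<longlongrightarrow> 0 ^ n) (at_right 0)"
        by (intro tendsto_intros)
      ultimately have "((\<lambda>t::real. t ^ n * (t * ln t)) \<longlongrightarrow> 0 ^ n * 0) (at_right 0)"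
        by (intro tendsto_mult)
      then have "((\<lambda>t::real. t ^ Suc n * ln t) \<longlongrightarrow> 0) (at 0 within {0..})"
        by (simp add: at_within_Ici_at_right mult_ac)
      then show ?thesis by (rule tendsto_within_subset) auto
    qed
    show "continuous_on {0..1} F"
      unfolding continuous_on_def
    proof
      fix x :: real assume x: "x \<in> {0..1}"
      show "(F \<longlongrightarrow> F x) (at x within {0..1})"
      \<comment> \<open>At 0 the value \<open>ln 0\<close> is multiplied by
        \<open>0 ^ Suc n\<close>, so \<open>F 0 = 0\<close>, which is also the limit found in
        \<open>tl\<close>.\<close>
      proof (cases "x = 0")
        case True
        have "(F \<longlongrightarrow> 0 ^ Suc n / (real n + 1)^2 - 0 / (real n + 1)) (at 0 within {0..1})"
          unfolding F_def by (intro tendsto_diff tendsto_divide tendsto_const tl tendsto_power tendsto_ident_at) auto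
        then show ?thesis using True by (simp add: F_def)
      next
        case False
        then show ?thesis using x unfolding F_def by (intro tendsto_intros) auto
      qed
    qed
    fix x :: real assume x: "x \<in> {0<..<1}"
    have "(F has_real_derivative x ^ n * - ln x) (at x)"
    proof -
      define c where "c = real n + 1"
      have c: "c > 0" by (simp add: c_def)
      have p: "((\<lambda>t::real. t ^ Suc n) has_real_derivative c * x ^ n) (at x)"
        using DERIV_pow[of "Suc n" x] by (simp add: c_def add_ac)
      have l: "(ln has_real_derivative 1 / x) (at x)"
        using x DERIV_ln[of x] by (simp add: divide_inverse)
      have "((\<lambda>t. t ^ Suc n / c^2 - t ^ Suc n * ln t / c) has_real_derivative
          c * x ^ n / c^2 - (c * x ^ n * ln x + 1 / x * x ^ Suc n) / c) (at x)"
        by (intro DERIV_diff DERIV_cdivide DERIV_mult p l)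
      moreover have "c * x ^ n / c^2 - (c * x ^ n * ln x + 1 / x * x ^ Suc n) / c = x ^ n * - ln x"
        using c x by (simp add: field_simps power2_eq_square)
      ultimately show ?thesis by (simp add: F_def c_def)
    qed
    then show "(F has_vector_derivative x ^ n * - ln x) (at x)"
      by (simp add: has_real_derivative_iff_has_vector_derivative)
  qed simp
  then have "((\<lambda>t::real. t ^ n * - ln t) has_integral 1 / (real n + 1)^2) (cbox 0 1)"
    by (simp add: F_def)
  then have "((\<lambda>t::real. t ^ n * - ln t) has_integral 1 / (real n + 1)^2) (box 0 1)"
    by (simp only: has_integral_open_interval)
  then show ?thesis by simp
qed

section \<open>The density and its invariance\<close>

text \<open>Since artanh t is half of ln ((1 + t) / (1 - t)), the first term is artanh t / t. In
  this form both terms are logarithms, one of (1 - t) / (1 + t) and one of t, and the involution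
  exchanges the two arguments.\<close>

definition selfdual_density :: "real \<Rightarrow> real" where
  "selfdual_density t = - ln ((1 - t) / (1 + t)) / (2 * t) - ln t / (1 - t^2)"

lemma selfdual_density_nonneg:
  assumes "t \<in> {0<..<1}" shows "0 \<le> selfdual_density t"
proof -
  have "t^2 < 1" using assms by (simp add: power_less_one_iff)
  moreover have "(1 - t) / (1 + t) \<le> 1" "(1 - t) / (1 + t) > 0" using assms by auto
  then have "ln ((1 - t) / (1 + t)) \<le> 0" by (simp del: ln_div)
  moreover have "ln t \<le> 0" using assms by simp
  ultimately show ?thesis
    unfolding selfdual_density_def using assms
    by (smt (verit, best) divide_nonneg_pos divide_minus_left greaterThanLessThan_iff)
qed

text \<open>The map is an involution with derivative -2 / (1 + t)^2. After multiplication by the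
  Jacobian, each of the two terms of the density becomes the other one.\<close>

lemma selfdual_density_moebius:
  assumes "t \<in> {0<..<1}"
  shows "2 / (1 + t)^2 * selfdual_density ((1 - t) / (1 + t)) = selfdual_density t"
proof -
  define s where "s = (1 - t) / (1 + t)"
  have t: "t > 0" "t < 1" using assms by auto
  have "(1 - s) / (1 + s) = t"
    unfolding s_def using t by (simp add: field_simps)
  moreover have "1 - s^2 = 4 * t / (1 + t)^2"
  proof -
    have "1 - s^2 = ((1 + t)^2 - (1 - t)^2) / (1 + t)^2"
      unfolding s_def using t by (subst power_divide) (simp add: diff_divide_distrib)
    also have "(1 + t)^2 - (1 - t)^2 = 4 * t" by algebra
    finally show ?thesis .
  qed
  ultimately have "selfdual_density s = - ln t / (2 * s) - ln s / (4 * t / (1 + t)^2)"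
    by (simp add: selfdual_density_def)
  moreover have "2 / (1 + t)^2 * (- ln t / (2 * s)) = - ln t / (1 - t^2)"
  proof -
    have "(1 + t)^2 * s = 1 - t^2" unfolding s_def using t by (simp add: field_simps power2_eq_square)
    then show ?thesis by (simp add: field_simps)
  qed
  moreover have "2 / (1 + t)^2 * (ln s / (4 * t / (1 + t)^2)) = ln s / (2 * t)"
    using t by (simp add: field_simps)
  ultimately have "2 / (1 + t)^2 * selfdual_density s = - ln t / (1 - t^2) - ln s / (2 * t)"
    by (simp only: right_diff_distrib)
  then show ?thesis by (simp add: selfdual_density_def s_def)
qed

text \<open>The series of artanh t / t is added to the geometric series of 1 / (1 - t^2) times -ln
  t. All terms are nonnegative, which prepares for monotone convergence.\<close>

lemma selfdual_density_sums:
  assumes "t \<in> {0<..<1}"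
  shows "(\<lambda>j. t ^ (2*j) / (2 * real j + 1) + t ^ (2*j) * - ln t) sums selfdual_density t"
proof -
  have t: "t > 0" "t < 1" using assms by auto
  have t2: "t^2 < 1" using t by (simp add: power_less_one_iff)
  \<comment> \<open>The quadratic logarithm series at x = (1+t)/(1-t) runs over powers of
    (x-1)/(x+1), and this quotient is t.\<close>
  have "(\<lambda>j. 2 * (((1+t)/(1-t) - 1) / ((1+t)/(1-t) + 1)) ^ (2*j+1) / of_nat (2*j+1)) sums ln ((1+t)/(1-t))"
    using t by (intro ln_series_quadratic) auto
  moreover have eq: "((1+t)/(1-t) - 1) / ((1+t)/(1-t) + 1) = t"
    using t by (simp add: field_simps)
  ultimately have "(\<lambda>j. 2 * t ^ (2*j+1) / (2 * real j + 1)) sums ln ((1+t)/(1-t))"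
    unfolding eq by (simp add: add.commute)
  then have "(\<lambda>j. 2 * t ^ (2*j+1) / (2 * real j + 1) / (2*t)) sums (ln ((1+t)/(1-t)) / (2*t))"
    by (rule sums_divide)
  have "ln ((1+t)/(1-t)) = - ln ((1-t)/(1+t))"
    using t by (simp add: ln_div)
  have "(\<lambda>j. t ^ (2*j) / (2 * real j + 1)) sums (- ln ((1-t)/(1+t)) / (2*t))"
  proof -
    have "2 * t ^ (2*j+1) / (2 * real j + 1) / (2*t) = t ^ (2*j) / (2 * real j + 1)" for j
      using t by simp
    with \<open>ln ((1+t)/(1-t)) = _\<close> show ?thesis
      using \<open>(\<lambda>j. 2 * t ^ (2*j+1) / (2 * real j + 1) / (2*t)) sums _\<close> by simp
  qed
  moreover have "(\<lambda>j. (t^2) ^ j * - ln t) sums (1 / (1 - t^2) * - ln t)"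
    using t2 by (intro sums_mult2 geometric_sums) simp
  ultimately show ?thesis
    unfolding selfdual_density_def
    by (auto simp flip: power_mult dest: sums_add)
qed

section \<open>Moments of the density\<close>

text \<open>Terms of the Basel series are grouped in pairs; the even squares account for a quarter
  of the total and are subtracted.\<close>

lemma odd_squares_sums: "(\<lambda>j. 1 / (2 * real j + 1)^2) sums (pi^2 / 8)"
proof -
  have s: "(\<lambda>n. 1 / (real n + 1)^2) sums (pi^2 / 6)"
    using inverse_squares_sums by (simp add: add_ac)
  have "(\<lambda>n. \<Sum>i = n*2..<n*2+2. 1 / (real i + 1)^2) sums (pi^2 / 6)"
    using sums_group[OF s, of 2] by simp
  then have "(\<lambda>n. 1 / (2 * real n + 1)^2 + 1 / (2 * real n + 2)^2) sums (pi^2 / 6)"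
    by (simp add: numeral_2_eq_2 mult_ac add_ac)
  moreover have "(\<lambda>n. 1/4 * (1 / (real n + 1)^2)) sums (1/4 * (pi^2 / 6))"
    by (intro sums_mult s)
  moreover have "1/4 * (1 / (real n + 1)^2) = 1 / (2 * real n + 2)^2" for n
    by (simp add: field_simps power2_eq_square)
  ultimately have "(\<lambda>n. 1 / (2 * real n + 1)^2 + 1 / (2 * real n + 2)^2 - 1 / (2 * real n + 2)^2)
      sums (pi^2 / 6 - 1/4 * (pi^2 / 6))"
    by (metis (no_types, lifting) ext sums_diff)
  then show ?thesis by simp
qed

text \<open>Termwise integration of t^n times the series of the density yields these two fractions.
  At n = 2i+1 they are the factors multiplying chi(N)/N, with N = 2i+1, in the double series A and
  D.\<close>

definition density_moment :: "nat \<Rightarrow> real" where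
  "density_moment n =
     (\<Sum>j. 1 / ((2 * real j + 1) * (real n + 2 * real j + 1)) + 1 / (real n + 2 * real j + 1)^2)"

lemma summable_density_moment:
  "summable (\<lambda>j. 1 / ((2 * real j + 1) * (real n + 2 * real j + 1)) + 1 / (real n + 2 * real j + 1)^2)"
proof (rule summable_comparison_test)
  show "summable (\<lambda>j. 2 * (1 / (2 * real j + 1)^2))"
    by (intro summable_mult sums_summable[OF odd_squares_sums])
  have "1 / ((2 * real j + 1) * (real n + 2 * real j + 1)) + 1 / (real n + 2 * real j + 1)^2
     \<le> 2 * (1 / (2 * real j + 1)^2)" for j
  proof -
    have "1 / ((2 * real j + 1) * (real n + 2 * real j + 1)) \<le> 1 / ((2 * real j + 1) * (2 * real j + 1))"
      by (intro divide_left_mono mult_left_mono mult_pos_pos) auto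
    moreover have "1 / (real n + 2 * real j + 1)^2 \<le> 1 / (2 * real j + 1)^2"
      by (intro divide_left_mono power_mono mult_pos_pos) auto
    ultimately show ?thesis by (simp add: power2_eq_square)
  qed
  then show "\<exists>N. \<forall>j\<ge>N. norm (1 / ((2 * real j + 1) * (real n + 2 * real j + 1)) + 1 / (real n + 2 * real j + 1)^2)
     \<le> 2 * (1 / (2 * real j + 1)^2)"
    by (intro exI[of _ 0]) auto
qed

text \<open>The partial sums of the series of the density increase on the open interval, so monotone
  convergence permits termwise integration.\<close>

lemma selfdual_density_moment:
  "((\<lambda>t. t ^ n * selfdual_density t) has_integral density_moment n) {0<..<1}"
proof (rule has_integral_monotone_convergence_increasing)
  let ?g = "\<lambda>j t. t ^ (n + 2*j) / (2 * real j + 1) + t ^ (n + 2*j) * - ln t"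
  let ?c = "\<lambda>j. 1 / ((2 * real j + 1) * (real n + 2 * real j + 1)) + 1 / (real n + 2 * real j + 1)^2"
  show "((\<lambda>t. \<Sum>j<k. ?g j t) has_integral (\<Sum>j<k. ?c j)) {0<..<1}" for k
  proof (rule has_integral_sum)
    fix j
    have "((\<lambda>t. t ^ (n + 2*j) / (2 * real j + 1)) has_integral
        (1 / (real (n + 2*j) + 1)) / (2 * real j + 1)) {0<..<1}"
      by (intro has_integral_divide power_has_integral_01)
    from has_integral_add[OF this power_ln_has_integral_01[of "n + 2*j"]]
    show "(?g j has_integral ?c j) {0<..<1}" by (simp add: mult_ac)
  qed simp
  show "(\<Sum>j<k. ?g j t) \<le> (\<Sum>j<Suc k. ?g j t)" if "t \<in> {0<..<1}" for k t
  proof -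
    have "t ^ (n + 2*k) * - ln t \<ge> 0" "t ^ (n + 2*k) / (2 * real k + 1) \<ge> 0"
      using that by (intro mult_nonneg_nonneg divide_nonneg_nonneg zero_le_power; force)+
    then show ?thesis by simp
  qed
  show "(\<lambda>k. \<Sum>j<k. ?g j t) \<longlonglongrightarrow> t ^ n * selfdual_density t" if "t \<in> {0<..<1}" for t
    using sums_mult[OF selfdual_density_sums[OF that], of "t ^ n"]
    unfolding sums_def by (simp add: power_add algebra_simps)
  show "(\<lambda>k. \<Sum>j<k. ?c j) \<longlonglongrightarrow> density_moment n"
    using summable_sums[OF summable_density_moment[of n]]
    unfolding sums_def density_moment_def .
qed

text \<open>In the moment of order 0 both fractions are 1 / (2j+1)^2, and each part contributes pi^2
  / 8.\<close>

lemma selfdual_density_integral: "(selfdual_density has_integral pi^2 / 4) {0<..<1}"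
proof -
  have "(\<lambda>j. 1 / (2 * real j + 1)^2 + 1 / (2 * real j + 1)^2) sums (pi^2 / 8 + pi^2 / 8)"
    by (intro sums_add odd_squares_sums)
  then have "density_moment 0 = pi^2 / 4"
    by (simp add: density_moment_def sums_iff power2_eq_square)
  with selfdual_density_moment[of 0] show ?thesis by (metis (no_types, lifting) has_integral_cong mult_1 power_0)
qed

section \<open>The arctangent integral\<close>

text \<open>The subtraction formula for the tangent gives the value. The assumption on t puts arctan
  t above -pi/4, so that pi/4 - arctan t stays in the range of arctan.\<close>

lemma arctan_moebius:
  assumes "t > -1" shows "arctan ((1 - t) / (1 + t)) = pi / 4 - arctan t"
proof -
  have "t \<noteq> -1" using assms by simp
  have "-(pi/2) < pi/4 - arctan t" "pi/4 - arctan t < pi/2"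
  proof -
    show "-(pi/2) < pi/4 - arctan t" using arctan_ubound[of t] pi_gt_zero by linarith
    have "arctan (-1) < arctan t" using assms by (simp add: arctan_less_iff)
    then show "pi/4 - arctan t < pi/2" by (simp add: arctan_minus arctan_one)
  qed
  moreover have "tan (pi/4 - arctan t) = (1 - t) / (1 + t)"
  proof -
    have "cos (pi/4 - arctan t) \<noteq> 0" using calculation cos_gt_zero_pi by force
    moreover have "cos (pi/4) \<noteq> 0" by (simp add: cos_45)
    ultimately show ?thesis
      by (subst tan_diff) (auto simp: tan_45 tan_arctan cos_arctan_not_zero)
  qed
  ultimately show ?thesis by (rule arctan_unique)
qed

text \<open>The substitution t to (1 - t) / (1 + t) preserves the density and turns arctan t into
  pi/4 - arctan t. Hence the integral I satisfies I = (pi/4) (pi^2/4) - I.\<close>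

lemma arctan_selfdual_density_integral:
  "((\<lambda>t. arctan t * selfdual_density t) has_integral pi^3 / 32) {0<..<1}"
proof -
  let ?f = "\<lambda>t. arctan t * selfdual_density t"
  let ?S = "{0<..<1::real}"
  have ai: "selfdual_density absolutely_integrable_on ?S"
    using selfdual_density_integral selfdual_density_nonneg
    by (intro nonnegative_absolutely_integrable_1) auto
  have af: "?f absolutely_integrable_on ?S"
  proof (rule absolutely_integrable_bounded_measurable_product_real[of arctan, OF _ _ _ ai])
    show "arctan \<in> borel_measurable (lebesgue_on ?S)"
      by (intro continuous_imp_measurable_on_sets_lebesgue continuous_intros) auto
    show "bounded (arctan ` ?S)"
      unfolding bounded_iff using arctan_bounded[THEN conjunct1] arctan_bounded[THEN conjunct2]
      by (intro exI[of _ "pi/2"]) (auto simp: abs_le_iff intro: less_imp_le)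
  qed auto
  let ?g = "\<lambda>t::real. (1 - t) / (1 + t)"
  have img: "?g ` ?S = ?S"
  proof
    show "?g ` ?S \<subseteq> ?S" by (auto simp: field_simps)
    show "?S \<subseteq> ?g ` ?S"
    proof
      fix t :: real assume t: "t \<in> ?S"
      then have "?g t \<in> ?S" "?g (?g t) = t" by (auto simp: field_simps)
      then show "t \<in> ?g ` ?S" by (intro image_eqI[of t ?g "?g t"]) simp_all
    qed
  qed
  \<comment> \<open>Change of variables is an equivalence for any prescribed value. With
    \<open>integral ?S ?f\<close> as that value, the right side holds by \<open>af\<close> and
    \<open>img\<close>, and the left side is the transformed integral.\<close>
  have "(\<lambda>x. \<bar>- 2 / (1 + x)^2\<bar> * ?f (?g x)) absolutely_integrable_on ?S \<and>
           integral ?S (\<lambda>x. \<bar>- 2 / (1 + x)^2\<bar> * ?f (?g x)) = integral ?S ?f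
     \<longleftrightarrow> ?f absolutely_integrable_on (?g ` ?S) \<and> integral (?g ` ?S) ?f = integral ?S ?f"
  proof (rule has_absolute_integral_change_of_variables_1')
    show "(?g has_real_derivative - 2 / (1 + x)^2) (at x within ?S)" if "x \<in> ?S" for x
      using that by (auto intro!: derivative_eq_intros simp: field_simps power2_eq_square)
    show "inj_on ?g ?S"
    proof (rule inj_on_inverseI)
      show "?g (?g t) = t" if "t \<in> ?S" for t using that by (simp add: field_simps)
    qed
  qed auto
  then have "integral ?S ?f = integral ?S (\<lambda>x. \<bar>- 2 / (1 + x)^2\<bar> * ?f (?g x))"
    using af img by simp
  also have "\<dots> = integral ?S (\<lambda>x. pi/4 * selfdual_density x - ?f x)"
  proof (rule integral_cong)
    fix x assume x: "x \<in> ?S"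
    have "\<bar>- 2 / (1 + x)^2\<bar> * ?f (?g x) = arctan (?g x) * (2 / (1 + x)^2 * selfdual_density (?g x))"
      by (simp add: mult_ac)
    also have "\<dots> = (pi/4 - arctan x) * selfdual_density x"
      using x by (subst selfdual_density_moebius, simp, subst arctan_moebius) auto
    finally show "\<bar>- 2 / (1 + x)^2\<bar> * ?f (?g x) = pi/4 * selfdual_density x - ?f x"
      by (simp add: left_diff_distrib)
  qed
  also have "\<dots> = pi/4 * (pi^2/4) - integral ?S ?f"
  proof (rule integral_unique)
    show "((\<lambda>x. pi/4 * selfdual_density x - ?f x) has_integral pi/4 * (pi^2/4) - integral ?S ?f) ?S"
      using af by (intro has_integral_diff has_integral_mult_right selfdual_density_integral
          integrable_integral set_lebesgue_integral_eq_integral(1))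
  qed
  finally have "integral ?S ?f = pi^3/32" by (simp add: power3_eq_cube power2_eq_square)
  then show ?thesis
    using af by (metis integrable_integral set_lebesgue_integral_eq_integral(1))
qed

text \<open>The arctangent integral is expanded by the power series of arctan. Partial sums of that
  series lie between 0 and t, hence below 1, so the density itself is the dominating function. The
  result is the evaluation of A + D.\<close>

lemma alternating_moments_sums:
  "(\<lambda>i. (-1)^i / (2 * real i + 1) * density_moment (2*i + 1)) sums (pi^3 / 32)"
proof -
  let ?S = "{0<..<1::real}"
  let ?a = "\<lambda>t i. t ^ (2*i+1) / (2 * real i + 1)"
  let ?f = "\<lambda>k t. (\<Sum>i<k. (-1)^i * ?a t i) * selfdual_density t"
  have fk: "(?f k has_integral (\<Sum>i<k. (-1)^i / (2 * real i + 1) * density_moment (2*i + 1))) ?S" for k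
  proof -
    have "((\<lambda>t. \<Sum>i<k. (-1)^i / (2 * real i + 1) * (t ^ (2*i+1) * selfdual_density t)) has_integral
        (\<Sum>i<k. (-1)^i / (2 * real i + 1) * density_moment (2*i + 1))) ?S"
      by (intro has_integral_sum has_integral_mult_right selfdual_density_moment) simp
    then show ?thesis unfolding sum_distrib_right by (simp add: mult_ac)
  qed
  have "(\<lambda>k. integral ?S (?f k)) \<longlonglongrightarrow> integral ?S (\<lambda>t. arctan t * selfdual_density t)"
  proof (rule dominated_convergence(2))
    show "?f k integrable_on ?S" for k using fk by blast
    show "selfdual_density integrable_on ?S" using selfdual_density_integral by blast
    fix t :: real assume t: "t \<in> ?S"
    show "norm (?f k t) \<le> selfdual_density t" for k
    proof -
      have "0 \<le> (\<Sum>i<k. (-1)^i * ?a t i) \<and> (\<Sum>i<k. (-1)^i * ?a t i) \<le> ?a t 0"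
      proof (rule alternating_partial_sum_bounds)
        show "?a t (Suc i) \<le> ?a t i" for i
          using t by (intro frac_le power_decreasing) auto
      qed (use t in auto)
      then have "norm (\<Sum>i<k. (-1)^i * ?a t i) \<le> 1" using t by simp
      then show ?thesis
        using selfdual_density_nonneg[OF t] unfolding norm_mult
        by (simp add: mult_left_le_one_le)
    qed
    have "(\<lambda>i. (-1)^i * ?a t i) sums arctan t"
      using t summable_sums[OF summable_arctan_series[of t]] arctan_series[of t]
      by (simp add: mult_ac add_ac)
    then show "(\<lambda>k. ?f k t) \<longlonglongrightarrow> arctan t * selfdual_density t"
      unfolding sums_def by (intro tendsto_mult tendsto_const)
  qed
  then show ?thesis
    unfolding sums_def integral_unique[OF fk] integral_unique[OF arctan_selfdual_density_integral] .
qed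

section \<open>Alternating double series\<close>

text \<open>Put a = 2i+1 and b = 2j+1. Then i+j+1 = (a+b)/2 is at least sqrt (a b), so the kernel is
  at most (a b) powr (-3/2), a product of two summable sequences.\<close>

lemma summable_on_kernel:
  "(\<lambda>(i, j). 1 / ((2 * real i + 1) * (2 * real j + 1) * (real i + real j + 1))) summable_on UNIV"
proof -
  define p where "p = (\<lambda>i. (2 * real i + 1) powr (-3/2))"
  have "summable (\<lambda>i. real (Suc i) powr (-3/2))"
    using summable_Suc_iff[of "\<lambda>i. real i powr (-3/2)"] by (simp add: summable_real_powr_iff)
  then have "summable p"
  proof (rule summable_comparison_test[rotated])
    show "\<exists>N. \<forall>i\<ge>N. norm (p i) \<le> real (Suc i) powr (-3/2)"
      unfolding p_def by (auto intro!: powr_mono2')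
  qed
  then have p: "(p has_sum suminf p) UNIV"
    by (intro sums_nonneg_imp_has_sum summable_sums) (auto simp: p_def)
  have "(\<lambda>(i, j). p i * p j) summable_on UNIV \<times> UNIV"
  proof (rule summable_on_SigmaI)
    show "((\<lambda>j. case (i, j) of (i, j) \<Rightarrow> p i * p j) has_sum p i * suminf p) UNIV" for i
      using has_sum_cmult_right[OF p] by simp
    show "(\<lambda>i. p i * suminf p) summable_on UNIV"
      using has_sum_cmult_left[OF p] by (auto simp: summable_on_def)
  qed (auto simp: p_def)
  then have "(\<lambda>(i, j). p i * p j) summable_on UNIV" by simp
  then show ?thesis
  proof (rule summable_on_comparison_test)
    fix x :: "nat \<times> nat"
    obtain i j where x: "x = (i, j)" by force
    define a where "a = 2 * real i + 1"
    define b where "b = 2 * real j + 1"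
    have ab: "a > 0" "b > 0" by (simp_all add: a_def b_def)
    have "sqrt (a * b) \<le> (a + b) / 2"
      using ab by (intro arith_geo_mean_sqrt) auto
    then have "1 / (a * b * ((a + b) / 2)) \<le> 1 / (a * b * sqrt (a * b))"
      using ab by (intro divide_left_mono mult_left_mono mult_pos_pos) auto
    also have "\<dots> = (a * b) powr (-3/2)"
    proof -
      have "(a * b) powr (3/2) = (a * b) powr (1 + 1/2)" by simp
      also have "\<dots> = a * b * sqrt (a * b)"
        using ab by (subst powr_add) (simp add: powr_half_sqrt)
      finally show ?thesis using ab by (simp add: powr_minus_divide)
    qed
    also have "\<dots> = p i * p j"
      unfolding p_def a_def b_def by (subst powr_mult) auto
    also have "(a + b) / 2 = real i + real j + 1" by (simp add: a_def b_def)
    finally show "(case x of (i, j) \<Rightarrow> 1 / ((2 * real i + 1) * (2 * real j + 1) * (real i + real j + 1)))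
        \<le> (case x of (i, j) \<Rightarrow> p i * p j)"
      by (simp add: x a_def b_def)
  qed auto
qed

text \<open>In absolute value the terms are below the kernel just treated. The lower bound on
  \<open>f\<close> is weak enough to cover the double series A, B and D alike.\<close>

lemma summable_on_alternating_kernel:
  fixes f :: "nat \<Rightarrow> nat \<Rightarrow> real"
  assumes "\<And>i j. f i j \<ge> (2 * real j + 1) * (real i + real j + 1)"
  shows "(\<lambda>(i, j). (-1)^i / (2 * real i + 1) * (1 / f i j)) summable_on UNIV"
proof (rule abs_summable_summable, rule summable_on_comparison_test[OF summable_on_kernel])
  fix x :: "nat \<times> nat"
  obtain i j where x: "x = (i, j)" by force
  have p: "0 < (2 * real j + 1) * (real i + real j + 1)" by (intro mult_pos_pos) auto
  have "norm ((-1)^i / (2 * real i + 1) * (1 / f i j)) = 1 / (2 * real i + 1) * (1 / f i j)"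
    using order.strict_trans2[OF p assms[where i=i and j=j]] by (simp add: abs_mult)
  also have "\<dots> \<le> 1 / (2 * real i + 1) * (1 / ((2 * real j + 1) * (real i + real j + 1)))"
    using p order.strict_trans2[OF p assms[where i=i and j=j]]
    by (intro mult_left_mono divide_left_mono mult_pos_pos assms) auto
  finally show "norm (case x of (i, j) \<Rightarrow> (-1)^i / (2 * real i + 1) * (1 / f i j))
     \<le> (case x of (i, j) \<Rightarrow> 1 / ((2 * real i + 1) * (2 * real j + 1) * (real i + real j + 1)))"
    by (simp add: x mult_ac)
qed auto

text \<open>Reindexing by (i, j) to (i + j, i) turns an unconditional sum into one over finite
  antidiagonals.\<close>

lemma has_sum_antidiagonals:
  fixes f :: "nat \<Rightarrow> nat \<Rightarrow> real"
  assumes "((\<lambda>(i, j). f i j) has_sum S) UNIV"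
  shows "(\<lambda>m. \<Sum>i\<le>m. f i (m - i)) sums S"
proof -
  have "((\<lambda>(m, i). f i (m - i)) has_sum S) (Sigma UNIV (\<lambda>m. {..m}))"
    using assms
    by (subst has_sum_reindex_bij_witness[where
          i = "\<lambda>(i, j). (i + j, i)" and j = "\<lambda>(m, i). (i, m - i)" and T = UNIV and
          h = "\<lambda>(i, j). f i j" and s' = S]) auto
  then have "((\<lambda>m. \<Sum>i\<le>m. f i (m - i)) has_sum S) UNIV"
    by (rule has_sum_SigmaD) (auto intro: has_sum_finite)
  then show ?thesis by (rule has_sum_imp_sums)
qed

text \<open>Fubini for unconditional sums. The rows inherit unconditional summability, and
  uniqueness of limits identifies their sums with the given values \<open>g i\<close>.\<close>

lemma has_sum_rows:
  fixes f :: "nat \<Rightarrow> nat \<Rightarrow> real"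
  assumes "((\<lambda>(i, j). f i j) has_sum S) UNIV" "\<And>i. f i sums g i"
  shows "g sums S"
proof -
  have "((\<lambda>(i, j). f i j) has_sum S) (UNIV \<times> UNIV)" using assms(1) by simp
  moreover have "((\<lambda>j. case (i, j) of (i, j) \<Rightarrow> f i j) has_sum g i) UNIV" for i
  proof -
    have "(\<lambda>(i, j). f i j) summable_on UNIV \<times> UNIV"
      using calculation by (auto simp: summable_on_def)
    then have "f i summable_on UNIV" by (rule summable_on_SigmaD1) simp
    then have "(f i has_sum infsum (f i) UNIV) UNIV" by simp
    moreover from has_sum_imp_sums[OF this] have "infsum (f i) UNIV = g i"
      using assms(2) sums_unique2 by blast
    ultimately show ?thesis by simp
  qed
  ultimately have "(g has_sum S) UNIV" by (rule has_sum_SigmaD)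
  then show ?thesis by (rule has_sum_imp_sums)
qed

lemma has_sum_columns:
  fixes f :: "nat \<Rightarrow> nat \<Rightarrow> real"
  assumes "((\<lambda>(i, j). f i j) has_sum S) UNIV" "\<And>j. (\<lambda>i. f i j) sums g j"
  shows "g sums S"
proof (rule has_sum_rows)
  show "((\<lambda>(j, i). f i j) has_sum S) UNIV"
    using assms(1) has_sum_swap[where f = "\<lambda>(i, j). f i j" and A = UNIV and B = UNIV and S = S] by simp
qed (rule assms(2))

section \<open>Antidiagonals and columns in terms of the Leibniz series\<close>

text \<open>This is E(k) at the even number k = 2m+2, since the odd numbers below k are 2i+1 with i
  \<le> m.\<close>

definition leibniz_sum :: "nat \<Rightarrow> real" where
  "leibniz_sum m = (\<Sum>i\<le>m. (-1)^i / (2 * real i + 1))"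

lemma leibniz_sums: "(\<lambda>i. (-1)^i / (2 * real i + 1)) sums (pi / 4)"
proof -
  have "(\<lambda>k. (-1)^k * (1 / real (k*2+1) * 1 ^ (k*2+1))) sums arctan 1"
    unfolding arctan_series[of 1, simplified abs_one, OF order_refl]
    by (intro summable_sums summable_arctan_series) simp
  moreover have eq: "(-1)^k * (1 / real (k*2+1) * 1 ^ (k*2+1)) = (-1)^k / (2 * real k + 1)" for k
    by (simp add: mult.commute)
  ultimately show ?thesis unfolding eq arctan_one by (simp only:)
qed

text \<open>On the antidiagonal a = 2i+1 and b = 2(m-i)+1 have the constant sum 2m+2, and 1/(a b) =
  (1/a + 1/b)/(a+b). The 1/b part is the same Leibniz sum read backwards, with sign (-1)^m.\<close>

lemma antidiagonal_odd:
  "(\<Sum>i\<le>m. (-1)^i / (2 * real i + 1) *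
      (1 / ((2 * real (m - i) + 1) * (2 * real i + 2 * real (m - i) + 2))))
   = (1 + (-1)^m) * leibniz_sum m / (2 * real m + 2)^2"
proof -
  let ?e = "\<lambda>i. (-1)^i / (2 * real i + 1)"
  have "(\<Sum>i\<le>m. ?e i * (1 / ((2 * real (m - i) + 1) * (2 * real i + 2 * real (m - i) + 2))))
      = (\<Sum>i\<le>m. (?e i + (-1)^m * ?e (m - i)) / (2 * real m + 2)^2)"
  proof (rule sum.cong)
    fix i assume "i \<in> {..m}"
    then have i: "i \<le> m" by simp
    define a b where "a = 2 * real i + 1" and "b = 2 * real (m - i) + 1"
    have pos: "a > 0" "b > 0" by (simp_all add: a_def b_def)
    have ab: "2 * real m + 2 = a + b" "2 * real i + 2 * real (m - i) + 2 = a + b"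
      using i by (simp_all add: a_def b_def of_nat_diff)
    have "(-1::real)^m * (-1)^(m - i) = (-1)^i"
    proof -
      have "(-1::real)^(i + k) * (-1)^k = (-1)^i" for k
        by (simp add: power_add mult.assoc flip: power_mult_distrib)
      from this[of "m - i"] show ?thesis using i by simp
    qed
    then have "?e i + (-1)^m * ?e (m - i) = (-1)^i * (1 / a + 1 / b)"
      by (simp add: a_def b_def distrib_left)
    also have "1 / a + 1 / b = (a + b) / (a * b)" using pos by (simp add: field_simps)
    also have "(-1)^i * ((a + b) / (a * b)) / (a + b)^2 = (-1)^i / a * (1 / (b * (a + b)))"
      using pos by (simp add: power2_eq_square)
    finally show "?e i * (1 / ((2 * real (m - i) + 1) * (2 * real i + 2 * real (m - i) + 2)))
        = (?e i + (-1)^m * ?e (m - i)) / (2 * real m + 2)^2"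
      unfolding ab by (simp add: a_def b_def)
  qed simp
  also have "\<dots> = (leibniz_sum m + (-1)^m * (\<Sum>i\<le>m. ?e (m - i))) / (2 * real m + 2)^2"
    unfolding leibniz_sum_def sum_divide_distrib[symmetric] sum.distrib sum_distrib_left by simp
  also have "(\<Sum>i\<le>m. ?e (m - i)) = leibniz_sum m"
    unfolding leibniz_sum_def by (rule sum.reindex_bij_witness[of _ "\<lambda>i. m - i" "\<lambda>i. m - i"]) auto
  finally show ?thesis by (simp add: algebra_simps)
qed

text \<open>With a = 2i+1 and b = 2m+2, b/(a(a+b)) = 1/a - 1/(a+b). The first part gives the full
  Leibniz series; since a+b = 2(i+m+1)+1, the second gives its tail after m, up to sign.\<close>

lemma column_even_sums:
  "(\<lambda>i. (-1)^i / (2 * real i + 1) * (1 / ((2 * real m + 2) * (2 * real i + 2 * real m + 3)))) sums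
     ((pi / 4 + (-1)^m * (pi / 4 - leibniz_sum m)) / (2 * real m + 2)^2)"
proof -
  let ?e = "\<lambda>i. (-1)^i / (2 * real i + 1)"
  have "(\<lambda>i. ?e (i + Suc m)) sums (pi / 4 - leibniz_sum m)"
    using sums_split_initial_segment[OF leibniz_sums, of "Suc m"]
    by (simp add: leibniz_sum_def lessThan_Suc_atMost)
  then have "(\<lambda>i. (?e i + (-1)^m * ?e (i + Suc m)) / (2 * real m + 2)^2) sums
     ((pi / 4 + (-1)^m * (pi / 4 - leibniz_sum m)) / (2 * real m + 2)^2)"
    by (intro sums_divide sums_add sums_mult leibniz_sums)
  moreover have "(?e i + (-1)^m * ?e (i + Suc m)) / (2 * real m + 2)^2
      = ?e i * (1 / ((2 * real m + 2) * (2 * real i + 2 * real m + 3)))" for i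
  proof -
    define a b where "a = 2 * real i + 1" and "b = 2 * real m + 2"
    have pos: "a > 0" "b > 0" by (simp_all add: a_def b_def)
    have ab: "2 * real (i + Suc m) + 1 = a + b" "2 * real i + 2 * real m + 3 = a + b"
      by (simp_all add: a_def b_def)
    have "(-1)^m * (-1)^(i + Suc m) = - ((-1)^i :: real)"
      by (simp add: power_add mult.left_commute[of "(-1)^m"])
    then have "?e i + (-1)^m * ?e (i + Suc m) = (-1)^i * (1 / a - 1 / (a + b))"
      unfolding ab a_def[symmetric] by (simp add: right_diff_distrib)
    also have "1 / a - 1 / (a + b) = b / (a * (a + b))" using pos by (simp add: field_simps)
    also have "(-1)^i * (b / (a * (a + b))) / b^2 = (-1)^i / a * (1 / (b * (a + b)))"
      using pos by (simp add: power2_eq_square)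
    finally show ?thesis unfolding ab a_def b_def .
  qed
  ultimately show ?thesis by simp
qed

text \<open>Odd m contribute 0, and m = 2j contributes half of 1/(2j+1)^2. Multiplied by pi/4 this
  will be the value of B + A - D.\<close>

lemma even_index_squares_sums:
  "(\<lambda>m. (1 + (-1)^m) / (2 * real m + 2)^2) sums (pi^2 / 16)"
proof -
  have "(\<lambda>j. 1/2 * (1 / (2 * real j + 1)^2)) sums (1/2 * (pi^2 / 8))"
    by (intro sums_mult odd_squares_sums)
  moreover have "1/2 * (1 / (2 * real j + 1)^2) = (1 + (-1)^(2*j)) / (2 * real (2*j) + 2)^2" for j
  proof -
    have "(2 * real (2*j) + 2)^2 = 4 * (2 * real j + 1)^2" by (simp add: power2_eq_square algebra_simps)
    then show ?thesis by simp
  qed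
  ultimately have "(\<lambda>j. (1 + (-1)^(2*j)) / (2 * real (2*j) + 2)^2) sums (pi^2 / 16)" by simp
  then show ?thesis
  proof (subst (asm) sums_mono_reindex[where f = "\<lambda>m. (1 + (-1)^m) / (2 * real m + 2)^2"])
    show "(1 + (-1)^m) / (2 * real m + 2)^2 = 0" if "m \<notin> range ((*) 2)" for m
    proof -
      have "odd m" using that by (auto elim: evenE)
      then show ?thesis by simp
    qed
  qed (auto simp: strict_mono_def)
qed

section \<open>Two linear relations and the value of 4A + 2B\<close>

text \<open>For N = 2i+1 this is the sum of 1/(K(N+K)) over odd K, the inner sum of A;
  \<open>even_column\<close> is its analogue over even k, the inner sum of B.\<close>

definition odd_column :: "nat \<Rightarrow> real" where
  "odd_column i = (\<Sum>j. 1 / ((2 * real j + 1) * (2 * real i + 2 * real j + 2)))"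

definition even_column :: "nat \<Rightarrow> real" where
  "even_column i = (\<Sum>m. 1 / ((2 * real m + 2) * (2 * real i + 2 * real m + 3)))"

lemma summable_inverse_quadratic:
  fixes f :: "nat \<Rightarrow> real"
  assumes "\<And>j. f j \<ge> (2 * real j + 1)^2"
  shows "summable (\<lambda>j. 1 / f j)"
proof (rule summable_comparison_test[OF _ sums_summable[OF odd_squares_sums]])
  have "norm (1 / f j) \<le> 1 / (2 * real j + 1)^2" for j
  proof -
    have "0 < (2 * real j + 1)^2" by simp
    with assms[of j] have "f j > 0" by linarith
    then show ?thesis using assms[of j] by (auto intro!: divide_left_mono)
  qed
  then show "\<exists>N. \<forall>j\<ge>N. norm (1 / f j) \<le> 1 / (2 * real j + 1)^2" by blast
qed

text \<open>Row sums express the left side as 4A + 2B, which equals 2(A + D) + 2(B + A - D). The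
  integral gives A + D = pi^3/32; rearrangement gives B + A - D = pi^3/64.\<close>

lemma alternating_columns_sums:
  "(\<lambda>i. (-1)^i / (2 * real i + 1) * (4 * odd_column i + 2 * even_column i)) sums (3 * pi^3 / 32)"
proof -
  let ?e = "\<lambda>i. (-1)^i / (2 * real i + 1)"
  let ?a = "\<lambda>i j. ?e i * (1 / ((2 * real j + 1) * (2 * real i + 2 * real j + 2)))"
  let ?d = "\<lambda>i j. ?e i * (1 / (2 * real i + 2 * real j + 2)^2)"
  let ?b = "\<lambda>i m. ?e i * (1 / ((2 * real m + 2) * (2 * real i + 2 * real m + 3)))"
  have "(\<lambda>(i, j). ?a i j) summable_on UNIV"
    by (intro summable_on_alternating_kernel mult_left_mono) auto
  then obtain A where A: "((\<lambda>(i, j). ?a i j) has_sum A) UNIV" by (auto simp: summable_on_def)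
  have "(\<lambda>(i, j). ?d i j) summable_on UNIV"
    unfolding power2_eq_square by (intro summable_on_alternating_kernel mult_mono) auto
  then obtain D where D: "((\<lambda>(i, j). ?d i j) has_sum D) UNIV" by (auto simp: summable_on_def)
  have "(\<lambda>(i, j). ?b i j) summable_on UNIV"
    by (intro summable_on_alternating_kernel mult_mono) auto
  then obtain B where B: "((\<lambda>(i, j). ?b i j) has_sum B) UNIV" by (auto simp: summable_on_def)

  have sa: "summable (\<lambda>j. 1 / ((2 * real j + 1) * (2 * real i + 2 * real j + 2)))" for i
    by (intro summable_inverse_quadratic) (auto simp: power2_eq_square intro!: mult_mono)
  have sd: "summable (\<lambda>j. 1 / (2 * real i + 2 * real j + 2)^2)" for i
    by (intro summable_inverse_quadratic) (auto simp: power2_eq_square intro!: mult_mono)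
  have sb: "summable (\<lambda>m. 1 / ((2 * real m + 2) * (2 * real i + 2 * real m + 3)))" for i
    by (intro summable_inverse_quadratic) (auto simp: power2_eq_square intro!: mult_mono)
  have rA: "(\<lambda>i. ?e i * odd_column i) sums A"
    using summable_sums[OF sa] unfolding odd_column_def
    by (intro has_sum_rows[OF A] sums_mult) simp
  have rD: "(\<lambda>i. ?e i * (\<Sum>j. 1 / (2 * real i + 2 * real j + 2)^2)) sums D"
    using summable_sums[OF sd] by (intro has_sum_rows[OF D] sums_mult) simp
  have rB: "(\<lambda>i. ?e i * even_column i) sums B"
    using summable_sums[OF sb] unfolding even_column_def
    by (intro has_sum_rows[OF B] sums_mult) simp

  \<comment> \<open>The two fractions in an odd moment are exactly a row of A and a row of D without
    their common factor \<open>?e i\<close>.\<close>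
  have "density_moment (2*i + 1) = odd_column i + (\<Sum>j. 1 / (2 * real i + 2 * real j + 2)^2)" for i
    unfolding density_moment_def odd_column_def
    by (subst suminf_add[OF sa sd]) (simp add: add_ac)
  then have "(\<lambda>i. ?e i * density_moment (2*i + 1)) sums (A + D)"
    using sums_add[OF rA rD] by (simp add: distrib_left)
  then have AD: "A + D = pi^3 / 32"
    using alternating_moments_sums sums_unique2 by blast

  have dA: "(\<lambda>m. (1 + (-1)^m) * leibniz_sum m / (2 * real m + 2)^2) sums A"
    using has_sum_antidiagonals[OF A] unfolding antidiagonal_odd .
  have "(\<Sum>i\<le>m. ?d i (m - i)) = leibniz_sum m / (2 * real m + 2)^2" for m
    unfolding leibniz_sum_def sum_divide_distrib by (intro sum.cong) (auto simp: of_nat_diff)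
  then have dD: "(\<lambda>m. leibniz_sum m / (2 * real m + 2)^2) sums D"
    using has_sum_antidiagonals[OF D] by simp
  have cB: "(\<lambda>m. (pi / 4 + (-1)^m * (pi / 4 - leibniz_sum m)) / (2 * real m + 2)^2) sums B"
    by (intro has_sum_columns[OF B] column_even_sums)
  \<comment> \<open>In this combination the coefficients of \<open>leibniz_sum m\<close> are
    -(-1)^m, 1 + (-1)^m and -1. They cancel, and only a multiple of pi/4 remains.\<close>
  have "(\<lambda>m. (pi / 4 + (-1)^m * (pi / 4 - leibniz_sum m)) / (2 * real m + 2)^2 +
          (1 + (-1)^m) * leibniz_sum m / (2 * real m + 2)^2
          - leibniz_sum m / (2 * real m + 2)^2) sums (B + A - D)"
    by (intro sums_add sums_diff dA dD cB)
  moreover have "(pi / 4 + (-1)^m * (pi / 4 - leibniz_sum m)) / (2 * real m + 2)^2 +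
          (1 + (-1)^m) * leibniz_sum m / (2 * real m + 2)^2
          - leibniz_sum m / (2 * real m + 2)^2 = pi / 4 * ((1 + (-1)^m) / (2 * real m + 2)^2)" for m
    unfolding add_divide_distrib[symmetric] diff_divide_distrib[symmetric] times_divide_eq_right
    by (rule arg_cong[where f = "\<lambda>x. x / _"]) (simp add: algebra_simps)
  ultimately have "(\<lambda>m. pi / 4 * ((1 + (-1)^m) / (2 * real m + 2)^2)) sums (B + A - D)" by simp
  then have "B + A - D = pi / 4 * (pi^2 / 16)"
    using sums_mult[OF even_index_squares_sums] sums_unique2 by blast
  with AD have AB: "4 * A + 2 * B = 3 * pi^3 / 32"
    by (simp add: power3_eq_cube power2_eq_square)
  moreover have "(\<lambda>i. 4 * (?e i * odd_column i) + 2 * (?e i * even_column i)) sums (4 * A + 2 * B)"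
    by (intro sums_add sums_mult rA rB)
  moreover have eq: "4 * (?e i * odd_column i) + 2 * (?e i * even_column i)
      = ?e i * (4 * odd_column i + 2 * even_column i)" for i
    by (simp only: distrib_left mult.left_commute)
  ultimately show ?thesis unfolding AB eq by (simp only:)
qed

section \<open>Digamma and harmonic numbers\<close>

text \<open>Subtracting the defining series at x from that at y cancels the Euler constant and the
  harmonic terms.\<close>

lemma Digamma_difference_sums:
  fixes x y :: real
  assumes "x > 0" "y > 0"
  shows "(\<lambda>k. 1 / (x + real k) - 1 / (y + real k)) sums (Digamma y - Digamma x)"
proof -
  have "(\<lambda>k. inverse (of_nat (Suc k)) - inverse (z + of_nat k)) sums (Digamma z + euler_mascheroni)"
    if "z > 0" for z :: real
    using summable_sums[OF summable_Digamma[of z]] that by (simp add: Digamma_def)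
  from sums_diff[OF this[OF assms(2)] this[OF assms(1)]]
  show ?thesis by (simp add: inverse_eq_divide)
qed

text \<open>The reciprocals of the even numbers up to 2i+1 add up to half of
  \<open>harm i\<close>.\<close>

lemma harm_odd: "(\<Sum>k\<le>i. 1 / (2 * real k + 1)) = harm (2*i + 1) - harm i / 2"
proof (induction i)
  case 0
  then show ?case by (simp add: harm_def)
next
  case (Suc i)
  have "harm (2 * Suc i + 1) = harm (2*i + 1) + 1 / (2 * real i + 2) + 1 / (2 * real i + (3::real))"
    by (simp add: harm_Suc numeral_eq_Suc inverse_eq_divide add_ac)
  moreover have "1 / (2 * real i + 2) = inverse (real (Suc i)) / 2"
    by (simp add: field_simps)
  then have "harm (Suc i) / 2 = harm i / 2 + 1 / (2 * real i + (2::real))"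
    by (simp add: harm_Suc)
  moreover have "(\<Sum>k\<le>Suc i. 1 / (2 * real k + 1)) = (\<Sum>k\<le>i. 1 / (2 * real k + 1)) + 1 / (2 * real i + 3)"
    by (simp add: add_ac)
  ultimately show ?case using Suc.IH by linarith
qed

text \<open>Partial fractions with halved denominators: the columns run over integers in steps of 2,
  whereas the digamma series runs in steps of 1.\<close>

lemma reciprocal_difference:
  fixes a b :: real
  assumes "a \<noteq> 0" "b \<noteq> 0" "a \<noteq> b"
  shows "(1 / a - 1 / b) / (4 * (b - a)) = 1 / ((2 * a) * (2 * b))"
proof -
  have "1 / a - 1 / b = (b - a) / (a * b)" using assms by (simp add: field_simps)
  moreover have "x / (a * b) / (4 * x) = 1 / ((2 * a) * (2 * b))" if "x \<noteq> 0" for x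
    using that by simp
  from this[of "b - a"] have "(b - a) / (a * b) / (4 * (b - a)) = 1 / ((2 * a) * (2 * b))"
    using assms(3) by simp
  ultimately show ?thesis by metis
qed

text \<open>Partial fractions lead to psi(i+1) - psi(1/2), where psi(i+1) = H_i - gamma and psi(1/2)
  = -gamma - 2 ln 2.\<close>

lemma odd_column_sums:
  "(\<lambda>j. 1 / ((2 * real j + 1) * (2 * real i + 2 * real j + 2))) sums
     ((harm i + 2 * ln 2) / (2 * (2 * real i + 1)))"
proof -
  have "(\<lambda>j. 1 / (1/2 + real j) - 1 / (real (Suc i) + real j)) sums
          (Digamma (real (Suc i)) - Digamma (1/2))"
    by (rule Digamma_difference_sums) auto
  moreover have "Digamma (real (Suc i)) - Digamma (1/2) = harm i + 2 * ln 2"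
    using Digamma_of_nat[of i, where ?'a = real] Digamma_one_half[where ?'a = real] by simp
  ultimately have "(\<lambda>j. (1 / (1/2 + real j) - 1 / (real (Suc i) + real j)) / (2 * (2 * real i + 1))) sums
      ((harm i + 2 * ln 2) / (2 * (2 * real i + 1)))"
    by (intro sums_divide) simp
  moreover have "(1 / (1/2 + real j) - 1 / (real (Suc i) + real j)) / (2 * (2 * real i + 1))
      = 1 / ((2 * real j + 1) * (2 * real i + 2 * real j + 2))" for j
  proof -
    define a b where "a = 1/2 + real j" and "b = real (Suc i) + real j"
    have pos: "a > 0" "b > 0" by (simp_all add: a_def b_def)
    have ba: "2 * (2 * real i + 1) = 4 * (b - a)" by (simp add: a_def b_def)
    have "b - a > 0" by (simp add: a_def b_def)
    have "(1 / a - 1 / b) / (2 * (2 * real i + 1)) = 1 / ((2 * a) * (2 * b))"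
      unfolding ba using pos \<open>b - a > 0\<close> by (intro reciprocal_difference) auto
    then show ?thesis by (simp add: a_def b_def algebra_simps)
  qed
  ultimately show ?thesis by simp
qed

text \<open>Here partial fractions lead to psi(i + 3/2) - psi(1); the half-integer value involves
  reciprocals of odd numbers, which \<open>harm_odd\<close> converts.\<close>

lemma even_column_sums:
  "(\<lambda>m. 1 / ((2 * real m + 2) * (2 * real i + 2 * real m + 3))) sums
     ((2 * harm (2*i + 1) - harm i - 2 * ln 2) / (2 * (2 * real i + 1)))"
proof -
  have "(\<lambda>m. 1 / (1 + real m) - 1 / (real (Suc i) + 1/2 + real m)) sums
          (Digamma (real (Suc i) + 1/2) - Digamma 1)"
    by (rule Digamma_difference_sums) auto
  moreover have "Digamma (real (Suc i) + 1/2) - Digamma 1 = 2 * harm (2*i + 1) - harm i - 2 * ln 2"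
  proof -
    have "(\<Sum>k<Suc i. 2 / (2 * real k + 1)) = 2 * (\<Sum>k\<le>i. 1 / (2 * real k + 1))"
      unfolding sum_distrib_left lessThan_Suc_atMost by simp
    then show ?thesis
      using Digamma_half_integer[of "Suc i", where ?'a = real] harm_odd[of i] by (simp add: add_ac)
  qed
  ultimately have "(\<lambda>m. (1 / (1 + real m) - 1 / (real (Suc i) + 1/2 + real m)) / (2 * (2 * real i + 1))) sums
      ((2 * harm (2*i + 1) - harm i - 2 * ln 2) / (2 * (2 * real i + 1)))"
    by (intro sums_divide) simp
  moreover have "(1 / (1 + real m) - 1 / (real (Suc i) + 1/2 + real m)) / (2 * (2 * real i + 1))
      = 1 / ((2 * real m + 2) * (2 * real i + 2 * real m + 3))" for m
  proof -
    define a b where "a = 1 + real m" and "b = real (Suc i) + 1/2 + real m"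
    have pos: "a > 0" "b > 0" by (simp_all add: a_def b_def)
    have ba: "2 * (2 * real i + 1) = 4 * (b - a)" by (simp add: a_def b_def)
    have "b - a > 0" by (simp add: a_def b_def)
    have "(1 / a - 1 / b) / (2 * (2 * real i + 1)) = 1 / ((2 * a) * (2 * b))"
      unfolding ba using pos \<open>b - a > 0\<close> by (intro reciprocal_difference) auto
    then show ?thesis by (simp add: a_def b_def algebra_simps)
  qed
  ultimately show ?thesis by simp
qed

text \<open>The weights 4 and 2 are those for which the two closed forms combine to the numerator
  occurring in the recurrence of S_n.\<close>

lemma alternating_harmonic_sums:
  "(\<lambda>i. (-1)^i * ((2 * harm (2*i + 1) + harm i + 2 * ln 2) / (2 * real i + 1)^2)) sums (3 * pi^3 / 32)"
proof -
  have "(-1)^i / (2 * real i + 1) * (4 * odd_column i + 2 * even_column i)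
      = (-1)^i * ((2 * harm (2*i + 1) + harm i + 2 * ln 2) / (2 * real i + 1)^2)" for i
  proof -
    define N where "N = 2 * real i + 1"
    have N: "N > 0" by (simp add: N_def)
    have "odd_column i = (harm i + 2 * ln 2) / (2 * N)"
      using odd_column_sums[of i] by (simp add: odd_column_def sums_iff N_def)
    moreover have "even_column i = (2 * harm (2*i + 1) - harm i - 2 * ln 2) / (2 * N)"
      using even_column_sums[of i] by (simp add: even_column_def sums_iff N_def)
    ultimately have "4 * odd_column i + 2 * even_column i
        = (2 * harm (2*i + 1) + harm i + 2 * ln 2) / N"
      using N by (simp add: field_simps)
    then show ?thesis unfolding N_def[symmetric] by (simp add: power2_eq_square)
  qed
  then show ?thesis using alternating_columns_sums by simp
qed

section \<open>The recurrence for S_n\<close>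

text \<open>The value of S_n + S_{n+1} is \<open>psi_step (Suc n)\<close>. The shift makes 2r+1 run
  over all odd numbers, so that the alternating sum from r = 0 is a complete Euler sum.\<close>

definition psi_step :: "nat \<Rightarrow> real" where
  "psi_step r = - (7 * pi^2 / 12) / (2 * real r + 1)
     + (2 * harm (2*r + 1) + harm r + 2 * ln 2) / (2 * real r + 1)^2"

lemma inverse_squares_sums': "(\<lambda>k. 1 / (real (Suc k))^2) sums (pi^2 / 6)"
  using inverse_squares_sums by (simp add: add_ac)

text \<open>The first summand has digamma arguments x, x + 1/2, y, y + 1/2, and the second x + 1/2,
  x + 1, y + 1/2, y + 1. The middle values cancel, and psi(x+1) - psi(x) = 1/x does the
  rest.\<close>

lemma psi_summand_add_Suc:
  "psi_summand n (Suc k) + psi_summand (Suc n) (Suc k) =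
     (1 / (2 * (2 * real (Suc k) + 2 * real n + 3)) - 4 / (real (Suc k) + 2 * real n + 3)) / (real (Suc k))^2"
proof -
  define x where "x = (2 * real (Suc k) + 2 * real n + 3) / 4"
  define y where "y = (real (Suc k) + 2 * real n + 3) / 4"
  have pos: "x > 0" "y > 0" by (simp_all add: x_def y_def)
  have "psi_summand n (Suc k) = (1/8 * Digamma (x + 1/2) - Digamma (y + 1/2) + Digamma y - 1/8 * Digamma x)
      / (real (Suc k))^2"
    unfolding psi_summand_def x_def y_def by (simp add: add_divide_distrib add_ac)
  moreover have "psi_summand (Suc n) (Suc k) =
      (1/8 * Digamma (x + 1) - Digamma (y + 1) + Digamma (y + 1/2) - 1/8 * Digamma (x + 1/2))
      / (real (Suc k))^2"
    unfolding psi_summand_def x_def y_def by (simp add: add_divide_distrib add_ac)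
  ultimately have "psi_summand n (Suc k) + psi_summand (Suc n) (Suc k) =
      (1/8 * (1 / x) - 1 / y) / (real (Suc k))^2"
    using pos by (simp add: Digamma_plus1 add_divide_distrib diff_divide_distrib)
  then show ?thesis by (simp add: x_def y_def)
qed

text \<open>Partial fractions in q = k+1 split the summand into a multiple of 1/q^2, a digamma
  series with sum H_N, and the even column for i = n+1. The coefficient of 1/q^2 is 1/(2N) - 4/N =
  -7/(2N).\<close>

lemma psi_summand_add_Suc_sums:
  "(\<lambda>k. psi_summand n (Suc k) + psi_summand (Suc n) (Suc k)) sums psi_step (Suc n)"
proof -
  define N where "N = 2 * real (Suc n) + 1"
  have N: "N > 0" by (simp add: N_def)
  have "(\<lambda>k. 1 / (1 + real k) - 1 / (real (Suc (2*n + 3)) + real k)) sums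
          (Digamma (real (Suc (2*n + 3))) - Digamma 1)"
    by (rule Digamma_difference_sums) auto
  then have h: "(\<lambda>k. 1 / (1 + real k) - 1 / (real (Suc (2*n + 3)) + real k)) sums harm (2*n + 3)"
    using Digamma_of_nat[of "2*n + 3", where ?'a = real] by simp
  let ?V = "(2 * harm (2 * Suc n + 1) - harm (Suc n) - 2 * ln 2) / (2 * N)"
  have "(\<lambda>k. - (7 / (2 * N)) * (1 / (real (Suc k))^2)
        + 4 / N^2 * (1 / (1 + real k) - 1 / (real (Suc (2*n + 3)) + real k))
        - 2 / N * (1 / ((2 * real k + 2) * (2 * real (Suc n) + 2 * real k + 3))))
      sums (- (7 / (2 * N)) * (pi^2 / 6) + 4 / N^2 * harm (2*n + 3) - 2 / N * ?V)"
    unfolding N_def by (intro sums_add sums_diff sums_mult inverse_squares_sums' h even_column_sums)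
  moreover have "- (7 / (2 * N)) * (1 / (real (Suc k))^2)
        + 4 / N^2 * (1 / (1 + real k) - 1 / (real (Suc (2*n + 3)) + real k))
        - 2 / N * (1 / ((2 * real k + 2) * (2 * real (Suc n) + 2 * real k + 3)))
      = psi_summand n (Suc k) + psi_summand (Suc n) (Suc k)" for k
  proof -
    define q where "q = real (Suc k)"
    have q: "q > 0" by (simp add: q_def)
    have e: "1 + real k = q" "real (Suc (2*n + 3)) + real k = q + N" "2 * real k + 2 = 2 * q"
       "2 * real (Suc n) + 2 * real k + 3 = 2 * q + N"
       "2 * q + 2 * real n + 3 = 2 * q + N" "q + 2 * real n + 3 = q + N"
      by (simp_all add: q_def N_def)
    have "4 / N^2 * (1 / q - 1 / (q + N)) = 4 / N * (1 / q^2) - 4 / (q + N) / q^2"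
    proof -
      have "1 / q - 1 / (q + N) = N / (q * (q + N))"
        using q N by (simp add: field_simps)
      then have "4 / N^2 * (1 / q - 1 / (q + N)) = 4 / (N * q * (q + N))"
        using N by (simp add: power2_eq_square)
      \<comment> \<open>The numerator q is written as (q + N) - N so that the fraction
        splits.\<close>
      also have "\<dots> = 4 * (q + N - N) / (N * (q + N) * q^2)"
        using q by (simp add: power2_eq_square)
      also have "\<dots> = 4 / N * (1 / q^2) - 4 / (q + N) / q^2"
      proof -
        have "4 * (d - N) / (N * d * q^2) = 4 / N * (1 / q^2) - 4 / d / q^2" if "d > 0" for d
          using that q N by (simp add: field_simps)
        from this[of "q + N"] show ?thesis using q N by simp
      qed
      finally show ?thesis .
    qed
    moreover have "2 / N * (1 / (2 * q * (2 * q + N))) = 1 / (2 * N) * (1 / q^2) - 1 / (2 * (2 * q + N)) / q^2"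
    proof -
      have "2 / N * (1 / (2 * q * (2 * q + N))) = (2 * q + N - N) / (2 * N * (2 * q + N) * q^2)"
        using q by (simp add: power2_eq_square)
      moreover have "(d - N) / (2 * N * d * q^2) = 1 / (2 * N) * (1 / q^2) - 1 / (2 * d) / q^2" if "d > 0" for d
        using that q N by (simp add: field_simps)
      from this[of "2 * q + N"]
      have "(2 * q + N - N) / (2 * N * (2 * q + N) * q^2) = 1 / (2 * N) * (1 / q^2) - 1 / (2 * (2 * q + N)) / q^2"
        using q N by simp
      ultimately show ?thesis by metis
    qed
    moreover have "7 / (2 * N) * x = 4 / N * x - 1 / (2 * N) * x" for x
      by simp
    ultimately show ?thesis unfolding psi_summand_add_Suc q_def[symmetric] e diff_divide_distrib
      by simp
  qed
  moreover have "- (7 / (2 * N)) * (pi^2 / 6) + 4 / N^2 * harm (2*n + 3) - 2 / N * ?V = psi_step (Suc n)"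
  proof -
    have i: "2 * Suc n + 1 = 2*n + 3" by simp
    have "2 / N * ?V = (2 * harm (2*n + 3) - harm (Suc n) - 2 * ln 2) / N^2"
    proof -
      have "2 / N * (x / (2 * N)) = x / N^2" for x
        using N by (simp add: power2_eq_square)
      then show ?thesis unfolding i by blast
    qed
    then show ?thesis
      unfolding psi_step_def N_def[symmetric] i by (simp add: add_divide_distrib diff_divide_distrib)
  qed
  ultimately show ?thesis by simp
qed

section \<open>Convergence, decay and the value of S_0\<close>

lemma Digamma_half_shift_bounds:
  fixes x :: real
  assumes "x > 0"
  shows "0 \<le> Digamma (x + 1/2) - Digamma x" "Digamma (x + 1/2) - Digamma x \<le> 1 / x"
proof -
  show "0 \<le> Digamma (x + 1/2) - Digamma x" using Digamma_real_mono[of x "x + 1/2"] assms by simp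
  have "Digamma (x + 1/2) \<le> Digamma (x + 1)" using assms by (intro Digamma_real_mono) auto
  then show "Digamma (x + 1/2) - Digamma x \<le> 1 / x" using assms by (simp add: Digamma_plus1)
qed

text \<open>Both half-step differences lie between 0 and 4/(2n+3) by monotonicity of digamma, hence
  so does the modulus of their combination with weights 1/8 and -1. The bound yields convergence of
  the series as well as S_n tending to 0.\<close>

lemma psi_summand_bound:
  "\<bar>psi_summand n (Suc k)\<bar> \<le> 4 / (2 * real n + 3) * (1 / (real (Suc k))^2)"
proof -
  define c where "c = 2 * real n + 3"
  define x where "x = (2 * real (Suc k) + c) / 4"
  define y where "y = (real (Suc k) + 2 * real n + 3) / 4"
  have c: "c > 0" by (simp add: c_def)
  have pos: "x > 0" "y > 0" by (simp_all add: x_def y_def c_def)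
  have "1 / x \<le> 4 / c" "1 / y \<le> 4 / c"
    using c by (auto simp: x_def y_def c_def intro!: divide_left_mono)
  moreover have "\<bar>1/8 * u - v\<bar> \<le> e" if "0 \<le> u" "u \<le> e" "0 \<le> v" "v \<le> e" for u v e :: real
    using that by linarith
  ultimately have "\<bar>1/8 * (Digamma (x + 1/2) - Digamma x) - (Digamma (y + 1/2) - Digamma y)\<bar> \<le> 4 / c"
    using Digamma_half_shift_bounds[OF pos(1)] Digamma_half_shift_bounds[OF pos(2)] by force
  then have "\<bar>1/8 * (Digamma (x + 1/2) - Digamma x) - (Digamma (y + 1/2) - Digamma y)\<bar> / (real (Suc k))^2
     \<le> 4 / c / (real (Suc k))^2"
    by (rule divide_right_mono) simp
  moreover have "psi_summand n (Suc k) =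
      (1/8 * (Digamma (x + 1/2) - Digamma x) - (Digamma (y + 1/2) - Digamma y)) / (real (Suc k))^2"
    unfolding psi_summand_def x_def y_def c_def by (simp add: add_divide_distrib add_ac right_diff_distrib)
  ultimately show ?thesis by (simp add: c_def)
qed

definition psi_series :: "nat \<Rightarrow> real" where
  "psi_series n = (\<Sum>k. psi_summand n (Suc k))"

lemma psi_series_sums: "(\<lambda>k. psi_summand n (Suc k)) sums psi_series n"
  unfolding psi_series_def
proof (rule summable_sums, rule summable_comparison_test)
  show "summable (\<lambda>k. 4 / (2 * real n + 3) * (1 / (real (Suc k))^2))"
    by (intro summable_mult sums_summable[OF inverse_squares_sums'])
  show "\<exists>N. \<forall>k\<ge>N. norm (psi_summand n (Suc k)) \<le> 4 / (2 * real n + 3) * (1 / (real (Suc k))^2)"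
    using psi_summand_bound by auto
qed

lemma psi_series_Suc: "psi_series (Suc n) = psi_step (Suc n) - psi_series n"
  using sums_unique2[OF sums_add[OF psi_series_sums psi_series_sums] psi_summand_add_Suc_sums[of n]]
  by simp

text \<open>The recurrence alone fixes S_n only up to a multiple of (-1)^n; this limit removes the
  ambiguity.\<close>

lemma psi_series_tendsto_0: "psi_series \<longlonglongrightarrow> 0"
proof (rule Lim_null_comparison)
  have "norm (psi_series n) \<le> 4 / (2 * real n + 3) * (pi^2 / 6)" for n
  proof -
    have s: "(\<lambda>k. 4 / (2 * real n + 3) * (1 / (real (Suc k))^2)) sums (4 / (2 * real n + 3) * (pi^2 / 6))"
      by (intro sums_mult inverse_squares_sums')
    have "norm (\<Sum>k. psi_summand n (Suc k)) \<le> (\<Sum>k. 4 / (2 * real n + 3) * (1 / (real (Suc k))^2))"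
      using psi_summand_bound by (intro norm_suminf_le sums_summable[OF s]) auto
    then show ?thesis using s by (simp add: psi_series_def sums_iff)
  qed
  then show "\<forall>\<^sub>F n in sequentially. norm (psi_series n) \<le> 4 / (2 * real n + 3) * (pi^2 / 6)" by simp
  have "filterlim (\<lambda>n. 2 * real n + 3) at_top sequentially"
    unfolding add.commute[of _ 3]
    by (intro filterlim_tendsto_add_at_top[OF tendsto_const]
        filterlim_tendsto_pos_mult_at_top[OF tendsto_const _ filterlim_real_sequentially]) auto
  then have "(\<lambda>n. 4 / (2 * real n + 3)) \<longlonglongrightarrow> 0"
    by (intro tendsto_divide_0[OF tendsto_const] filterlim_at_top_imp_at_infinity)
  from tendsto_mult_right[OF this, of "pi^2 / 6"]
  show "(\<lambda>n. 4 / (2 * real n + 3) * (pi^2 / 6)) \<longlonglongrightarrow> 0" by (simp add: mult.commute)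
qed

text \<open>Telescoping (-1)^n S_n gives S_0 as the alternating sum of
  \<open>psi_step (Suc n)\<close>. The full sum from r = 0 is -(7 pi^2/12)(pi/4) + 3 pi^3/32 = -5
  pi^3/96, so S_0 is \<open>psi_step 0\<close> plus 5 pi^3/96.\<close>

lemma psi_series_0: "psi_series 0 = 2 * (1 + ln 2) - 7 * pi^2 / 12 + 5 * pi^3 / 96"
proof -
  have "(\<lambda>n. (-1)^n * psi_series n) \<longlonglongrightarrow> 0"
    by (rule tendsto_rabs_zero_cancel) (use tendsto_rabs_zero[OF psi_series_tendsto_0] in \<open>simp add: abs_mult\<close>)
  then have "(\<lambda>n. (-1)^n * psi_series n - (-1)^Suc n * psi_series (Suc n)) sums ((-1)^0 * psi_series 0 - 0)"
    by (rule telescope_sums')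
  moreover have "(-1)^n * psi_series n - (-1)^Suc n * psi_series (Suc n) = - ((-1)^Suc n * psi_step (Suc n))" for n
    by (simp add: psi_series_Suc algebra_simps)
  ultimately have "(\<lambda>n. - ((-1)^Suc n * psi_step (Suc n))) sums psi_series 0" by simp
  from sums_minus[OF this]
  have "(\<lambda>n. (-1)^Suc n * psi_step (Suc n)) sums (- psi_series 0)" by simp
  then have "(\<lambda>n. (-1)^n * psi_step n) sums (- psi_series 0 + psi_step 0)"
    by (subst (asm) sums_Suc_iff) simp
  moreover have "(\<lambda>n. (-1)^n * psi_step n) sums (- (7 * pi^2 / 12) * (pi / 4) + 3 * pi^3 / 32)"
  proof -
    have "(\<lambda>n. - (7 * pi^2 / 12) * ((-1)^n / (2 * real n + 1))
        + (-1)^n * ((2 * harm (2*n + 1) + harm n + 2 * ln 2) / (2 * real n + 1)^2))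
        sums (- (7 * pi^2 / 12) * (pi / 4) + 3 * pi^3 / 32)"
      by (intro sums_add sums_mult leibniz_sums alternating_harmonic_sums)
    moreover have "- (7 * pi^2 / 12) * ((-1)^n / (2 * real n + 1))
        + (-1)^n * ((2 * harm (2*n + 1) + harm n + 2 * ln 2) / (2 * real n + 1)^2)
        = (-1)^n * psi_step n" for n
      unfolding psi_step_def distrib_left by simp
    ultimately show ?thesis by simp
  qed
  ultimately have "- psi_series 0 + psi_step 0 = - (7 * pi^2 / 12) * (pi / 4) + 3 * pi^3 / 32"
    by (rule sums_unique2)
  moreover have "psi_step 0 = 2 * (1 + ln 2) - 7 * pi^2 / 12"
    by (simp add: psi_step_def harm_def)
  ultimately show ?thesis by (simp add: power3_eq_cube power2_eq_square)
qed

section \<open>Closed forms for odd and even n\<close>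

text \<open>This is S_{n+2} - S_n for r = n+1. The first, second and fourth terms come from the
  differences of 1/N and 1/N^2; the third collects the new reciprocals 4/(N+1) + 2/(N+2) in the
  harmonic numbers.\<close>

lemma psi_step_Suc_diff:
  assumes "N = 2 * real r + 1"
  shows "psi_step (Suc r) - psi_step r =
     7 * pi^2 / 2 * (1 / 3 * (1 / ((N + 2) * N)))
     - 4 * (N + 1) * (2 * harm (2*r + 1) + harm r) / ((N + 2)^2 * N^2)
     + (6 * N + 10) / ((N + 1) * (N + 2)^3)
     - 2 * ln 2 * (4 * (N + 1) / ((N + 2)^2 * N^2))"
proof -
  define P where "P = 2 * harm (2*r + 1) + harm r + (2 * ln 2 :: real)"
  have N: "N > 0" by (simp add: assms)
  have e: "2 * real (Suc r) + 1 = N + 2" "2 * real r + 1 = N" by (simp_all add: assms)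
  have "harm (2 * Suc r + 1) = harm (2*r + 1) + 1 / (N + 1) + 1 / (N + 2)"
    by (simp add: harm_Suc inverse_eq_divide assms add_ac)
  moreover have "harm (Suc r) = harm r + 2 / (N + 1)"
  proof -
    have "2 / (N + 1) = inverse (real (Suc r))" unfolding assms by (simp add: field_simps)
    then show ?thesis by (simp add: harm_Suc)
  qed
  ultimately have "2 * harm (2 * Suc r + 1) + harm (Suc r) + 2 * ln 2 = P + (4 / (N + 1) + 2 / (N + 2))"
    by (simp add: P_def)
  moreover have "4 / (N + 1) + 2 / (N + 2) = (6 * N + 10) / ((N + 1) * (N + 2))"
    using N by (simp add: field_simps)
  ultimately have "psi_step (Suc r) = - (7 * pi^2 / 12) * (1 / (N + 2)) + P * (1 / (N + 2)^2)
      + (6 * N + 10) / ((N + 1) * (N + 2)) / (N + 2)^2"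
    unfolding psi_step_def e by (simp add: add_divide_distrib)
  moreover have "(6 * N + 10) / ((N + 1) * (N + 2)) / (N + 2)^2 = (6 * N + 10) / ((N + 1) * (N + 2)^3)"
    by (simp add: power3_eq_cube power2_eq_square mult.assoc)
  moreover have "psi_step r = - (7 * pi^2 / 12) * (1 / N) + P * (1 / N^2)"
    unfolding psi_step_def e P_def by simp
  moreover have "1 / (N + 2) = 1 / N - 2 * (1 / ((N + 2) * N))"
    using N by (simp add: divide_simps)
  moreover have "1 / (N + 2)^2 = 1 / N^2 - 4 * (N + 1) / ((N + 2)^2 * N^2)"
  proof -
    have "1 / N^2 - 1 / (N + 2)^2 = ((N + 2)^2 - N^2) / ((N + 2)^2 * N^2)"
      using N by (simp add: diff_divide_distrib)
    also have "(N + 2)^2 - N^2 = 4 * (N + 1)" by (simp add: power2_eq_square algebra_simps)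
    finally show ?thesis by simp
  qed
  ultimately have "psi_step (Suc r) - psi_step r =
     7 * pi^2 / 12 * (2 * (1 / ((N + 2) * N))) - P * (4 * (N + 1) / ((N + 2)^2 * N^2))
     + (6 * N + 10) / ((N + 1) * (N + 2)^3)"
    by (simp only: right_diff_distrib)
  moreover have "P * (4 * (N + 1) / ((N + 2)^2 * N^2)) =
      4 * (N + 1) * (2 * harm (2*r + 1) + harm r) / ((N + 2)^2 * N^2)
      + 2 * ln 2 * (4 * (N + 1) / ((N + 2)^2 * N^2))"
  proof -
    have "(x + l) * (c / d) = c * x / d + l * (c / d)" for x l c d :: real
      by (simp add: distrib_left distrib_right mult.commute add_divide_distrib)
    then show ?thesis unfolding P_def .
  qed
  ultimately show ?thesis by simp
qed

text \<open>Induction in steps of two from S_1 = \<open>psi_step 1\<close> - S_0. The increment with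
  index j is the difference formula at r = 2j, so N = 4j+1.\<close>

lemma psi_series_odd:
  "psi_series (2*m + 1) =
     - 40/27
     - 8 * (\<Sum>j = 1..m. (2 * real j + 1) * (2 * harm (4*j + 1) + harm (2*j))
                / ((4 * real j + 3)^2 * (4 * real j + 1)^2))
     + 4 * (\<Sum>j = 1..m. (3 * real j + 2) / ((2 * real j + 1) * (4 * real j + 3)^3))
     + 7 * pi^2 / 2 * (1/9 + 1/3 * (\<Sum>j = 1..m. 1 / ((4 * real j + 3) * (4 * real j + 1))))
     - 16 * ln 2 * (1/9 + (\<Sum>j = 1..m. (2 * real j + 1) / ((4 * real j + 3)^2 * (4 * real j + 1)^2)))
     - 5 * pi^3 / 96"
proof -
  define t1 :: "nat \<Rightarrow> real" where "t1 = (\<lambda>j. (2 * real j + 1) * (2 * harm (4*j + 1) + harm (2*j))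
                / ((4 * real j + 3)^2 * (4 * real j + 1)^2))"
  define t2 where "t2 = (\<lambda>j. (3 * real j + 2) / ((2 * real j + 1) * (4 * real j + 3)^3))"
  define t3 where "t3 = (\<lambda>j. 1 / ((4 * real j + 3) * (4 * real j + 1)))"
  define t4 where "t4 = (\<lambda>j. (2 * real j + 1) / ((4 * real j + 3)^2 * (4 * real j + 1)^2))"
  have step: "psi_series (2 * Suc m + 1) = psi_series (2*m + 1) - 8 * t1 (Suc m) + 4 * t2 (Suc m)
      + 7 * pi^2 / 2 * (1/3 * t3 (Suc m)) - 16 * ln 2 * t4 (Suc m)" for m
  proof -
    define j where "j = Suc m"
    have "psi_series (2*j + 1) = psi_series (2*m + 1) + (psi_step (Suc (2*j)) - psi_step (2*j))"
      using psi_series_Suc[of "2*j"] psi_series_Suc[of "2*m + 1"] by (simp add: j_def)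
    also have "psi_step (Suc (2*j)) - psi_step (2*j) =
        7 * pi^2 / 2 * (1 / 3 * (1 / ((4 * real j + 3) * (4 * real j + 1))))
        - 4 * (4 * real j + 2) * (2 * harm (2*(2*j) + 1) + harm (2*j)) / ((4 * real j + 3)^2 * (4 * real j + 1)^2)
        + (24 * real j + 16) / ((4 * real j + 2) * (4 * real j + 3)^3)
        - 2 * ln 2 * (4 * (4 * real j + 2) / ((4 * real j + 3)^2 * (4 * real j + 1)^2))"
      using psi_step_Suc_diff[of "4 * real j + 1" "2*j"] by (simp add: add_ac)
    also have "4 * (4 * real j + 2) = 8 * (2 * real j + 1)" by simp
    also have "(24 * real j + 16) / ((4 * real j + 2) * (4 * real j + 3)^3) = 4 * t2 j"
    proof -
      have "(24 * real j + 16) / ((4 * real j + 2) * (4 * real j + 3)^3)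
          = (2 * (4 * (3 * real j + 2))) / (2 * ((2 * real j + 1) * (4 * real j + 3)^3))"
        by (simp add: algebra_simps)
      also have "\<dots> = (4 * (3 * real j + 2)) / ((2 * real j + 1) * (4 * real j + 3)^3)"
        by (rule mult_divide_mult_cancel_left) simp
      finally show ?thesis by (simp add: t2_def)
    qed
    also have "2*(2*j) + 1 = 4*j + 1" by simp
    \<comment> \<open>Here c is 2j+1, h the harmonic combination, d the product of squares, p the
      pi^2 term, t the cubic-denominator term and l is ln 2.\<close>
    also have "s + (p - 8 * c * h / d + t - 2 * l * (8 * c / d)) = s - 8 * (c * h / d) + t + p - 16 * l * (c / d)"
      for s p c h d t l :: real
      by simp
    finally show ?thesis unfolding j_def[symmetric] t1_def t3_def t4_def .
  qed
  have "psi_series (2*m + 1) = - 40/27 - 8 * (\<Sum>j = 1..m. t1 j) + 4 * (\<Sum>j = 1..m. t2 j)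
     + 7 * pi^2 / 2 * (1/9 + 1/3 * (\<Sum>j = 1..m. t3 j))
     - 16 * ln 2 * (1/9 + (\<Sum>j = 1..m. t4 j)) - 5 * pi^3 / 96"
  proof (induction m)
    case 0
    have "psi_step 1 = - (7 * pi^2 / 36) + (14/3 + 2 * ln 2) / 9"
      by (simp add: psi_step_def harm_def numeral_eq_Suc)
    then show ?case
      using psi_series_Suc[of 0] by (simp add: psi_series_0 algebra_simps)
  next
    case (Suc m)
    show ?case unfolding step Suc.IH by (simp add: algebra_simps)
  qed
  then show ?thesis by (simp add: t1_def t2_def t3_def t4_def)
qed

text \<open>The same induction from S_0, with r = 2j+1 and N = 4j+3; the index j now starts at
  0.\<close>

lemma psi_series_even:
  "psi_series (2*m) =
     2
     - 16 * (\<Sum>j<m. (real j + 1) * (2 * harm (4*j + 3) + harm (2*j + 1))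
               / ((4 * real j + 5)^2 * (4 * real j + 3)^2))
     + (\<Sum>j<m. (6 * real j + 7) / ((real j + 1) * (4 * real j + 5)^3))
     - 7 * pi^2 / 2 * (1/6 - 1/3 * (\<Sum>j<m. 1 / ((4 * real j + 5) * (4 * real j + 3))))
     + 2 * ln 2 * (1 - 16 * (\<Sum>j<m. (real j + 1) / ((4 * real j + 5)^2 * (4 * real j + 3)^2)))
     + 5 * pi^3 / 96"
proof -
  define t1 :: "nat \<Rightarrow> real" where "t1 = (\<lambda>j. (real j + 1) * (2 * harm (4*j + 3) + harm (2*j + 1))
               / ((4 * real j + 5)^2 * (4 * real j + 3)^2))"
  define t2 where "t2 = (\<lambda>j. (6 * real j + 7) / ((real j + 1) * (4 * real j + 5)^3))"
  define t3 where "t3 = (\<lambda>j. 1 / ((4 * real j + 5) * (4 * real j + 3)))"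
  define t4 where "t4 = (\<lambda>j. (real j + 1) / ((4 * real j + 5)^2 * (4 * real j + 3)^2))"
  have step: "psi_series (2 * Suc j) = psi_series (2*j) - 16 * t1 j + t2 j
      + 7 * pi^2 / 2 * (1/3 * t3 j) - 2 * ln 2 * (16 * t4 j)" for j
  proof -
    have "psi_series (2 * Suc j) = psi_series (2*j) + (psi_step (Suc (2*j + 1)) - psi_step (2*j + 1))"
      using psi_series_Suc[of "2*j"] psi_series_Suc[of "2*j + 1"] by simp
    also have "psi_step (Suc (2*j + 1)) - psi_step (2*j + 1) =
        7 * pi^2 / 2 * (1 / 3 * (1 / ((4 * real j + 5) * (4 * real j + 3))))
        - 4 * (4 * real j + 4) * (2 * harm (2*(2*j + 1) + 1) + harm (2*j + 1)) / ((4 * real j + 5)^2 * (4 * real j + 3)^2)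
        + (24 * real j + 28) / ((4 * real j + 4) * (4 * real j + 5)^3)
        - 2 * ln 2 * (4 * (4 * real j + 4) / ((4 * real j + 5)^2 * (4 * real j + 3)^2))"
      using psi_step_Suc_diff[of "4 * real j + 3" "2*j + 1"] by (simp add: add_ac)
    also have "4 * (4 * real j + 4) = 16 * (real j + 1)" by simp
    also have "(24 * real j + 28) / ((4 * real j + 4) * (4 * real j + 5)^3) = t2 j"
    proof -
      have "(24 * real j + 28) / ((4 * real j + 4) * (4 * real j + 5)^3)
          = (4 * (6 * real j + 7)) / (4 * ((real j + 1) * (4 * real j + 5)^3))"
        by (simp add: algebra_simps)
      also have "\<dots> = (6 * real j + 7) / ((real j + 1) * (4 * real j + 5)^3)"
        by (rule mult_divide_mult_cancel_left) simp
      finally show ?thesis by (simp add: t2_def)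
    qed
    also have "2*(2*j + 1) + 1 = 4*j + 3" by simp
    finally show ?thesis
      unfolding t1_def t3_def t4_def by (simp add: mult.assoc)
  qed
  have "psi_series (2*m) = 2 - 16 * (\<Sum>j<m. t1 j) + (\<Sum>j<m. t2 j)
     - 7 * pi^2 / 2 * (1/6 - 1/3 * (\<Sum>j<m. t3 j))
     + 2 * ln 2 * (1 - 16 * (\<Sum>j<m. t4 j)) + 5 * pi^3 / 96"
  proof (induction m)
    case 0
    then show ?case by (simp add: psi_series_0 algebra_simps)
  next
    case (Suc m)
    show ?case unfolding step Suc.IH by (simp add: algebra_simps)
  qed
  then show ?thesis by (simp add: t1_def t2_def t3_def t4_def)
qed

(* The series over k >= 1 is indexed by Suc k.
   For even n, the range 0 \<le> j \<le> (n - 2)/2 is written j < n div 2, so that it is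
   empty for n = 0 in spite of truncated subtraction on nat. *)
theorem theorem13:
  fixes n :: nat
  shows
    "(n = 0 \<longrightarrow>
        (\<lambda>k. psi_summand n (Suc k)) sums
          (2 * (1 + ln 2) - 7 * pi^2 / 12 + 5 * pi^3 / 96))
   \<and> (n = 1 \<longrightarrow>
        (\<lambda>k. psi_summand n (Suc k)) sums
          (- 8/9 * (5/3 + 2 * ln 2) + 7 * pi^2 / 18 - 5 * pi^3 / 96))
   \<and> (odd n \<and> n \<noteq> 1 \<longrightarrow>
        (\<lambda>k. psi_summand n (Suc k)) sums
          (- 40/27
           - 8 * (\<Sum>j = 1..(n - 1) div 2.
                    (2 * real j + 1) * (2 * harm (4*j + 1) + harm (2*j))
                      / ((4 * real j + 3)^2 * (4 * real j + 1)^2))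
           + 4 * (\<Sum>j = 1..(n - 1) div 2.
                    (3 * real j + 2) / ((2 * real j + 1) * (4 * real j + 3)^3))
           + 7 * pi^2 / 2 *
               (1/9 + 1/3 * (\<Sum>j = 1..(n - 1) div 2.
                               1 / ((4 * real j + 3) * (4 * real j + 1))))
           - 16 * ln 2 *
               (1/9 + (\<Sum>j = 1..(n - 1) div 2.
                         (2 * real j + 1) / ((4 * real j + 3)^2 * (4 * real j + 1)^2)))
           - 5 * pi^3 / 96))
   \<and> (even n \<longrightarrow>
        (\<lambda>k. psi_summand n (Suc k)) sums
          (2
           - 16 * (\<Sum>j<n div 2.
                     (real j + 1) * (2 * harm (4*j + 3) + harm (2*j + 1))
                       / ((4 * real j + 5)^2 * (4 * real j + 3)^2))
           + (\<Sum>j<n div 2.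
                (6 * real j + 7) / ((real j + 1) * (4 * real j + 5)^3))
           - 7 * pi^2 / 2 *
               (1/6 - 1/3 * (\<Sum>j<n div 2.
                               1 / ((4 * real j + 5) * (4 * real j + 3))))
           + 2 * ln 2 *
               (1 - 16 * (\<Sum>j<n div 2.
                            (real j + 1) / ((4 * real j + 5)^2 * (4 * real j + 3)^2)))
           + 5 * pi^3 / 96))"
    (is "(_ \<longrightarrow> ?zero) \<and> (_ \<longrightarrow> ?one) \<and> (_ \<longrightarrow> ?odd) \<and> (_ \<longrightarrow> ?even)")
proof (intro conjI impI)
  assume "n = 0"
  then show ?zero using psi_series_sums[of 0] by (simp add: psi_series_0)
next
  assume "n = 1"
  \<comment> \<open>The case n = 1 is the odd formula with empty sums.\<close>
  moreover have "psi_series 1 = - 8/9 * (5/3 + 2 * ln 2) + 7 * pi^2 / 18 - 5 * pi^3 / 96"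
    using psi_series_odd[of 0] by (simp add: algebra_simps)
  ultimately show ?one using psi_series_sums[of 1] by simp
next
  assume "odd n \<and> n \<noteq> 1"
  then have n: "2 * ((n - 1) div 2) + 1 = n" by presburger
  show ?odd
    using psi_series_sums[of n] unfolding psi_series_odd[of "(n - 1) div 2", unfolded n] .
next
  assume "even n"
  then have n: "2 * (n div 2) = n" by presburger
  show ?even
    using psi_series_sums[of n] unfolding psi_series_even[of "n div 2", unfolded n] .
qed

end
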